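(* Consider a four-body convex central configuration with positive masses, with bodies labeled consecutively counterclockwise so that $r_{12}$ is the largest exterior side, and let $\theta$ be the angle between the two diagonals, i.e. the angle $\angle q_1Oq_2$ where $O$ is the intersection point of the diagonals $\overline{q_1q_3}$ and $\overline{q_2q_4}$. Then $\pi/3<\theta\le\pi/2$. If $\theta=\pi/2$, the configuration must be a kite.
   Context: For bodies at pairwise distinct positions $q_1,\dots,q_4\in\mathbb{R}^2$ with masses $m_1,\dots,m_4>0$, put $M=\sum_i m_i$, $r_{ij}=\|q_i-q_j\|$, $U(q)=\sum_{i<j} m_im_j/r_{ij}$ and $I(q)=\frac1M\sum_{i<j}m_im_jr_{ij}^2$. The configuration $q=(q_1,\dots,q_4)\in\mathbb{R}^8$ is a (planar) central configuration if it is a critical point of $U$ subject to the constraint $I=I_0$, for some constant $I_0>0$. It is convex if no body lies in the convex hull of the other three (so, labeled consecutively, $q_1q_2q_3q_4$ is a strictly convex quadrilateral with diagonals $\overline{q_1q_3}$, $\overline{q_2q_4}$ and exterior sides of lengths $r_{12},r_{23},r_{34},r_{14}$). A kite is a quadrilateral symmetric about a line, with two of the bodies lying on the axis of symmetry and the other two positioned equidistant from it (as mirror images of each other). In the paper's coordinates, after an isometry and rescaling, $q_1=(1,0)$, $q_2=(a\cos\theta,a\sin\theta)$, $q_3=(-b,0)$, $q_4=(-c\cos\theta,-c\sin\theta)$ with $a,b,c>0$, $\theta\in(0,\pi)$, and this $\theta$ is the angle in the statement. *)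

theory Defs
  imports "HOL-Analysis.Analysis"
begin

text \<open>
  A configuration of four bodies in the plane is an element of \<open>real^2^4\<close>, i.e. of
  \<open>\<real>\<^sup>8\<close> with its Euclidean norm. In the index type \<open>4\<close> the numeral \<open>4\<close> equals \<open>0\<close>, and
  addition is modulo 4. So \<open>i + 1\<close> is the cyclic successor of \<open>i\<close>. In the linear order of
  this type \<open>4\<close> comes first; this does not affect sums of a symmetric expression over \<open>i < j\<close>.
\<close>

definition total_mass :: "real^4 \<Rightarrow> real" where
  "total_mass m = (\<Sum>i\<in>UNIV. m $ i)"

definition potential :: "real^4 \<Rightarrow> real^2^4 \<Rightarrow> real" where
  "potential m q = (\<Sum>(i, j) \<in> {(i, j). i < j}. m $ i * m $ j / dist (q $ i) (q $ j))"

definition inertia :: "real^4 \<Rightarrow> real^2^4 \<Rightarrow> real" where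
  "inertia m q =
     1 / total_mass m * (\<Sum>(i, j) \<in> {(i, j). i < j}. m $ i * m $ j * (dist (q $ i) (q $ j))\<^sup>2)"

text \<open>
  Critical point of the restriction of \<open>f\<close> to the level set \<open>g = c\<close>: the derivative of \<open>f\<close>
  vanishes along every curve through \<open>x\<close> that lies in the level set near \<open>x\<close>. This is the usual
  notion when \<open>f\<close> is differentiable at \<open>x\<close> and the level set is a smooth hypersurface near \<open>x\<close>,
  as is the case for \<open>potential m\<close> and \<open>inertia m\<close> at configurations with distinct positions.
\<close>

definition constrained_critical_point ::
    "('a::real_normed_vector \<Rightarrow> real) \<Rightarrow> ('a \<Rightarrow> real) \<Rightarrow> real \<Rightarrow> 'a \<Rightarrow> bool" where
  "constrained_critical_point f g c x \<longleftrightarrow>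
     g x = c \<and>
     (\<forall>\<gamma> v. \<gamma> 0 = x \<longrightarrow> (\<gamma> has_vector_derivative v) (at 0) \<longrightarrow>
        (\<forall>\<^sub>F t in nhds 0. g (\<gamma> t) = c) \<longrightarrow>
        ((\<lambda>t. f (\<gamma> t)) has_real_derivative 0) (at 0))"

definition central_configuration :: "real^4 \<Rightarrow> real^2^4 \<Rightarrow> bool" where
  "central_configuration m q \<longleftrightarrow>
     inj (\<lambda>i. q $ i) \<and>
     (\<exists>I0>0. constrained_critical_point (potential m) (inertia m) I0 q)"

definition convex_configuration :: "real^2^4 \<Rightarrow> bool" where
  "convex_configuration q \<longleftrightarrow> (\<forall>i. q $ i \<notin> convex hull ((\<lambda>j. q $ j) ` (- {i})))"

text \<open>
  The bodies \<open>q $ 1, q $ 2, q $ 3, q $ 4\<close> are consecutive vertices in counterclockwise order: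
  one turns left at each vertex of the closed polygon. The \<open>2 \<times> 2\<close> determinant has two
  consecutive edge vectors as its rows.
\<close>

definition labeled_counterclockwise :: "real^2^4 \<Rightarrow> bool" where
  "labeled_counterclockwise q \<longleftrightarrow>
     (\<forall>i. det (vector [q $ (i + 1) - q $ i, q $ (i + 2) - q $ (i + 1)] :: real^2^2) > 0)"

definition angle_at :: "real^2 \<Rightarrow> real^2 \<Rightarrow> real^2 \<Rightarrow> real" where
  "angle_at A P B = arccos (((A - P) \<bullet> (B - P)) / (norm (A - P) * norm (B - P)))"

definition line_through :: "real^2 \<Rightarrow> real^2 \<Rightarrow> (real^2) set" where
  "line_through a u = {a + t *\<^sub>R u | t. True}"

text \<open>Intended for \<open>u \<noteq> 0\<close>: this is \<open>2p - x\<close>, where \<open>p\<close> is the foot of the perpendicular from \<open>x\<close>.\<close>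

definition line_reflection :: "real^2 \<Rightarrow> real^2 \<Rightarrow> real^2 \<Rightarrow> real^2" where
  "line_reflection a u x = a + (2 * (((x - a) \<bullet> u) / (u \<bullet> u))) *\<^sub>R u - (x - a)"

definition is_kite :: "real^2^4 \<Rightarrow> bool" where
  "is_kite q \<longleftrightarrow>
     (\<exists>a u i j k l. u \<noteq> 0 \<and> {i, j, k, l} = (UNIV :: 4 set) \<and>
        q $ i \<in> line_through a u \<and> q $ j \<in> line_through a u \<and>
        q $ l = line_reflection a u (q $ k))"

end

theory Submission
  imports Defs
begin

text \<open>
  Let \<open>S\<^sub>i\<^sub>j = 1 / r\<^sub>i\<^sub>j ^ 3 - l\<close> with \<open>l\<close> the normalized Lagrange multiplier. For a convex central
  configuration \<open>S\<^sub>1\<^sub>2 S\<^sub>3\<^sub>4 = S\<^sub>1\<^sub>4 S\<^sub>2\<^sub>3 = S\<^sub>1\<^sub>3 S\<^sub>2\<^sub>4\<close> (Dziobek), with \<open>S > 0\<close> on the exterior sides and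
  \<open>- l < S < 0\<close> on the diagonals, so the common product is less than \<open>l\<^sup>2\<close>. On a hyperbola
  \<open>u v = C \<le> 1\<close> the sum \<open>(1 + u) powr (-2/3) + (1 + v) powr (-2/3)\<close> decreases as \<open>(u, v)\<close> moves away
  from the diagonal \<open>u = v\<close>. Since \<open>r\<^sub>i\<^sub>j\<^sup>2\<close> is proportional to \<open>(1 + S\<^sub>i\<^sub>j / l) powr (-2/3)\<close> and \<open>r\<^sub>1\<^sub>2\<close> is the
  longest side, \<open>r\<^sub>1\<^sub>2\<^sup>2 + r\<^sub>3\<^sub>4\<^sup>2 \<le> r\<^sub>1\<^sub>4\<^sup>2 + r\<^sub>2\<^sub>3\<^sup>2\<close>, with equality only if \<open>r\<^sub>1\<^sub>2\<close> equals \<open>r\<^sub>1\<^sub>4\<close> or \<open>r\<^sub>2\<^sub>3\<close>.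
  The right side minus the left side is a positive multiple of \<open>cos \<theta>\<close>. If \<open>cos \<theta> \<ge> 1 / 2\<close>, then
  \<open>r\<^sub>1\<^sub>4 \<le> r\<^sub>1\<^sub>2\<close> and \<open>r\<^sub>2\<^sub>3 \<le> r\<^sub>1\<^sub>2\<close> would make each of \<open>P q\<^sub>1\<close> and \<open>P q\<^sub>2\<close> shorter than the other.
\<close>

section \<open>Monotonicity along a hyperbola\<close>

text \<open>The difference of the two sides has the factor \<open>v - u\<close>. Written with
  \<open>w = u * v\<close>, the cofactor is positive because \<open>w \<le> 1\<close> lets
  \<open>10 * w\<^sup>2\<close> and \<open>5 * (w * (u + v))\<close> absorb the two negative
  terms.\<close>

lemma quotient_power_ineq:
  fixes u v :: real
  assumes "0 < u" "u < v" "u * v \<le> 1"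
  shows "u ^ 3 * (1 + v) ^ 5 < v ^ 3 * (1 + u) ^ 5"
proof -
  define w where "w = u * v"
  have w: "0 < w" "w \<le> 1" using assms by (auto simp: w_def)
  have "w ^ 3 \<le> w" "w ^ 3 \<le> w\<^sup>2"
    using w power_decreasing[of 1 3 w] power_decreasing[of 2 3 w] by auto
  moreover have "w ^ 3 * (u + v) \<le> w * (u + v)"
    using \<open>w ^ 3 \<le> w\<close> assms by (intro mult_right_mono) auto
  moreover have "0 < w * (u + v)" "0 < w\<^sup>2" using w assms by auto
  ultimately have "0 < u\<^sup>2 + w + v\<^sup>2 + 5 * (w * (u + v)) + 10 * w\<^sup>2 - 5 * w ^ 3 - w ^ 3 * (u + v)"
    using w zero_le_power2[of u] zero_le_power2[of v] by linarith
  then have "0 < (v - u) * (u\<^sup>2 + w + v\<^sup>2 + 5 * (w * (u + v)) + 10 * w\<^sup>2 - 5 * w ^ 3 - w ^ 3 * (u + v))"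
    using assms by simp
  also have "\<dots> = v ^ 3 * (1 + u) ^ 5 - u ^ 3 * (1 + v) ^ 5"
    unfolding w_def by algebra
  finally show ?thesis by simp
qed

text \<open>This is the cube root of \<open>quotient_power_ineq\<close>. It fixes the sign of the
  derivative of the sum of the two powers along \<open>u * v = C\<close> where \<open>u < v\<close>,
  since there \<open>C / u\<^sup>2 = v / u\<close>.\<close>

lemma powr_derivative_ineq:
  fixes u v :: real
  assumes "0 < u" "u < v" "u * v \<le> 1"
  shows "(1 + u) powr (-5/3) < (1 + v) powr (-5/3) * (v / u)"
proof -
  have "((1 + v) / (1 + u)) ^ 5 < (v / u) ^ 3"
    using quotient_power_ineq[OF assms] assms by (simp add: field_simps power_divide)
  then have "(((1 + v) / (1 + u)) ^ 5) powr (1/3) < ((v / u) ^ 3) powr (1/3)"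
    using assms by (intro powr_less_mono2) auto
  moreover have "(x ^ n) powr (1/3) = x powr (real n / 3)" if "0 < x" for x :: real and n
    by (simp only: powr_realpow[OF that, symmetric] powr_powr) simp
  ultimately have "((1 + v) / (1 + u)) powr (5/3) < v / u"
    using assms by simp
  then show ?thesis
    using assms by (simp add: powr_divide powr_minus field_simps)
qed

text \<open>With \<open>C = w * z\<close>, the sum becomes a function \<open>F\<close> of the first
  coordinate alone. Its derivative is positive wherever \<open>x < C / x\<close>, and this holds on
  the whole open interval from \<open>u\<close> to \<open>w\<close> because
  \<open>w * w \<le> C\<close>.\<close>

lemma powr_sum_strict_mono_hyperbola:
  fixes u v w z :: real
  assumes "0 < u" "u < w" "w \<le> z" "u * v = w * z" "w * z \<le> 1"
  shows "(1 + u) powr (-2/3) + (1 + v) powr (-2/3) < (1 + w) powr (-2/3) + (1 + z) powr (-2/3)"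
proof -
  define C where "C = w * z"
  have "0 < C" using assms by (simp add: C_def)
  define F where "F x = (1 + x) powr (-2/3) + (1 + C / x) powr (-2/3)" for x :: real
  have deriv: "(F has_real_derivative (2/3) * ((1 + C / x) powr (-5/3) * (C / x / x) - (1 + x) powr (-5/3))) (at x)"
    if "0 < x" for x
    unfolding F_def using that \<open>0 < C\<close>
    by (auto intro!: derivative_eq_intros simp: add_pos_pos field_simps power2_eq_square)
  have "F u < F w"
  proof (rule DERIV_pos_imp_increasing_open[OF \<open>u < w\<close>])
    fix x assume x: "u < x" "x < w"
    have "0 < x" "0 < w" using x assms by auto
    have "x * x < w * w" using x \<open>0 < x\<close> by (intro mult_strict_mono) auto
    also have "\<dots> \<le> C" unfolding C_def using assms by auto
    finally have "x < C / x" using \<open>0 < x\<close> by (simp add: field_simps)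
    then have "0 < (2/3) * ((1 + C / x) powr (-5/3) * (C / x / x) - (1 + x) powr (-5/3))"
      using powr_derivative_ineq[of x "C / x"] \<open>0 < x\<close> assms by (simp add: C_def)
    then show "\<exists>y. (F has_real_derivative y) (at x) \<and> y > 0"
      using deriv[OF \<open>0 < x\<close>] by blast
  next
    show "continuous_on {u..w} F"
      using assms(1) by (intro continuous_at_imp_continuous_on ballI DERIV_isCont[OF deriv]) auto
  qed
  moreover have "C / u = v" "C / w = z"
    using assms by (auto simp: C_def field_simps)
  ultimately show ?thesis by (simp add: F_def)
qed

text \<open>The sum is symmetric, so the strict monotonicity applies with the smaller of
  \<open>w\<close> and \<open>z\<close> as first coordinate. It fails to apply only if
  \<open>u\<close> equals one of them, and then \<open>v\<close> is the other.\<close>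

lemma hyperbola_comparison:
  fixes u v w z :: real
  assumes "0 < u" "u \<le> w" "u \<le> z" "u * v = w * z" "w * z \<le> 1"
  shows "(1 + u) powr (-2/3) + (1 + v) powr (-2/3) < (1 + w) powr (-2/3) + (1 + z) powr (-2/3) \<or>
    u = w \<and> v = z \<or> u = z \<and> v = w"
proof (cases "u = w \<or> u = z")
  case True
  then show ?thesis using assms mult_left_cancel[of u v] by (metis less_irrefl mult.commute)
next
  case False
  then have "u < w" "u < z" using assms by auto
  show ?thesis
  proof (cases "w \<le> z")
    case True
    then show ?thesis
      using powr_sum_strict_mono_hyperbola[of u w z v] \<open>u < w\<close> assms by blast
  next
    case False
    then have "z \<le> w" "u * v = z * w" "z * w \<le> 1" using assms by (auto simp: mult.commute)
    then show ?thesis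
      using powr_sum_strict_mono_hyperbola[of u z w v] \<open>u < z\<close> assms(1) by linarith
  qed
qed

section \<open>From criticality to the equations of a central configuration\<close>

text \<open>A double sum does not depend on the order of the index type, and the terms that involve
  one given body can be read off from it.\<close>

lemma sum_symmetric_pairs:
  fixes f :: "'a::{finite,linorder} \<Rightarrow> 'a \<Rightarrow> real"
  assumes sym: "\<And>i j. f i j = f j i" and diag: "\<And>i. f i i = 0"
  shows "(\<Sum>i\<in>UNIV. \<Sum>j\<in>UNIV. f i j) = 2 * (\<Sum>(i, j) \<in> {(i, j). i < j}. f i j)"
proof -
  let ?L = "{(i, j). i < (j::'a)}" and ?G = "{(i, j). j < (i::'a)}" and ?D = "{(i, j). i = (j::'a)}"
  have "(\<Sum>i\<in>UNIV. \<Sum>j\<in>UNIV. f i j) = (\<Sum>(i, j) \<in> UNIV. f i j)"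
    by (simp add: sum.cartesian_product)
  also have "UNIV = ?L \<union> ?G \<union> ?D" by auto
  also have "(\<Sum>(i, j) \<in> \<dots>. f i j) =
      (\<Sum>(i, j) \<in> ?L. f i j) + (\<Sum>(i, j) \<in> ?G. f i j) + (\<Sum>(i, j) \<in> ?D. f i j)"
    by (subst sum.union_disjoint; (subst sum.union_disjoint)?) auto
  also have "(\<Sum>(i, j) \<in> ?D. f i j) = 0"
    by (intro sum.neutral) (auto simp: diag)
  also have "(\<Sum>(i, j) \<in> ?G. f i j) = (\<Sum>(i, j) \<in> ?L. f i j)"
    by (rule sum.reindex_bij_witness[of _ prod.swap prod.swap]) (auto intro: sym)
  finally show ?thesis by simp
qed

lemma potential_scaleR: "potential m (c *\<^sub>R q) = potential m q / \<bar>c\<bar>"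
  unfolding potential_def sum_divide_distrib
  by (intro sum.cong refl) (auto simp: dist_norm mult_ac simp flip: scaleR_diff_right)

lemma inertia_scaleR: "inertia m (c *\<^sub>R q) = c\<^sup>2 * inertia m q"
  unfolding inertia_def
  by (simp add: dist_norm sum_distrib_left power_mult_distrib case_prod_beta mult_ac flip: scaleR_diff_right)

lemma has_real_derivative_dist_sq_line:
  fixes x y v w :: "'a::real_inner"
  shows "((\<lambda>t. (dist (x + t *\<^sub>R v) (y + t *\<^sub>R w))\<^sup>2) has_real_derivative
    2 * ((x - y) \<bullet> (v - w))) (at 0)"
proof -
  have "(dist (x + t *\<^sub>R v) (y + t *\<^sub>R w))\<^sup>2 =
      (x - y) \<bullet> (x - y) + 2 * t * ((x - y) \<bullet> (v - w)) + t\<^sup>2 * ((v - w) \<bullet> (v - w))" for t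
    unfolding dist_norm power2_norm_eq_inner
    by (simp add: inner_simps algebra_simps inner_commute power2_eq_square)
  then show ?thesis by (auto intro!: derivative_eq_intros)
qed

lemma has_real_derivative_inverse_dist_line:
  fixes x y v w :: "'a::real_inner"
  assumes "x \<noteq> y"
  shows "((\<lambda>t. 1 / dist (x + t *\<^sub>R v) (y + t *\<^sub>R w)) has_real_derivative
    - ((x - y) \<bullet> (v - w)) / dist x y ^ 3) (at 0)"
proof -
  have pos: "dist x y > 0" using assms by simp
  define g where "g t = (dist (x + t *\<^sub>R v) (y + t *\<^sub>R w))\<^sup>2" for t
  have g0: "g 0 = dist x y * dist x y" by (simp add: g_def power2_eq_square)
  have "(g has_real_derivative 2 * ((x - y) \<bullet> (v - w))) (at 0)"
    unfolding g_def by (rule has_real_derivative_dist_sq_line)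
  then have "((\<lambda>t. 1 / sqrt (g t)) has_real_derivative
    - ((x - y) \<bullet> (v - w)) / dist x y ^ 3) (at 0)"
    using pos by (auto intro!: derivative_eq_intros simp: g0 real_sqrt_mult field_simps power3_eq_cube)
  then show ?thesis by (simp add: g_def)
qed

lemma total_mass_pos:
  assumes "\<And>i. m $ i > 0"
  shows "total_mass m > 0"
  unfolding total_mass_def by (intro sum_pos) (auto simp: assms)

context
  fixes m :: "real^4" and q :: "real^2^4"
  assumes masses_pos: "\<And>i. m $ i > 0" and inj: "inj (\<lambda>i. q $ i)"
begin

lemma potential_pos: "potential m q > 0"
proof -
  have "(1::4, 2) \<in> {(i, j). i < j} \<or> (2::4, 1) \<in> {(i, j). i < j}"
    using less_linear[of "1::4" 2] by auto
  then have "{(i, j). i < (j::4)} \<noteq> {}" by blast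
  then show ?thesis
    unfolding potential_def using inj
    by (intro sum_pos) (auto simp: masses_pos inj_eq)
qed

lemma potential_line_derivative:
  "((\<lambda>t. potential m (q + t *\<^sub>R v)) has_real_derivative
     (\<Sum>(i, j) \<in> {(i, j). i < j}.
        m $ i * m $ j * (- ((q $ i - q $ j) \<bullet> (v $ i - v $ j)) / dist (q $ i) (q $ j) ^ 3))) (at 0)"
proof -
  have "((\<lambda>t. m $ i * m $ j * (1 / dist (q $ i + t *\<^sub>R v $ i) (q $ j + t *\<^sub>R v $ j))) has_real_derivative
     m $ i * m $ j * (- ((q $ i - q $ j) \<bullet> (v $ i - v $ j)) / dist (q $ i) (q $ j) ^ 3)) (at 0)" if "i < j" for i j
    using that inj
    by (intro DERIV_cmult has_real_derivative_inverse_dist_line) (auto simp: inj_eq)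
  then have "((\<lambda>t. \<Sum>p \<in> {(i, j). i < j}.
        m $ fst p * m $ snd p *
          (1 / dist (q $ fst p + t *\<^sub>R v $ fst p) (q $ snd p + t *\<^sub>R v $ snd p)))
      has_real_derivative
     (\<Sum>p \<in> {(i, j). i < j}.
        m $ fst p * m $ snd p *
          (- ((q $ fst p - q $ snd p) \<bullet> (v $ fst p - v $ snd p)) / dist (q $ fst p) (q $ snd p) ^ 3))) (at 0)"
    by (intro DERIV_sum) auto
  then show ?thesis by (simp add: potential_def case_prod_beta)
qed

lemma inertia_line_derivative:
  "((\<lambda>t. inertia m (q + t *\<^sub>R v)) has_real_derivative
     2 / total_mass m * (\<Sum>(i, j) \<in> {(i, j). i < j}. m $ i * m $ j * ((q $ i - q $ j) \<bullet> (v $ i - v $ j)))) (at 0)"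
proof -
  have "((\<lambda>t. 1 / total_mass m * (\<Sum>p \<in> {(i, j). i < j}.
        m $ fst p * m $ snd p *
          (dist (q $ fst p + t *\<^sub>R v $ fst p) (q $ snd p + t *\<^sub>R v $ snd p))\<^sup>2))
      has_real_derivative
     1 / total_mass m * (\<Sum>p \<in> {(i, j). i < j}.
        m $ fst p * m $ snd p *
          (2 * ((q $ fst p - q $ snd p) \<bullet> (v $ fst p - v $ snd p))))) (at 0)"
    by (intro DERIV_cmult DERIV_sum has_real_derivative_dist_sq_line)
  then show ?thesis
    by (simp add: inertia_def case_prod_beta sum_distrib_left mult_ac)
qed

text \<open>
  No tangency of \<open>v\<close> is needed: by homogeneity the curve \<open>sqrt (I0 / I (q + t v)) (q + t v)\<close> stays
  on the level set for every \<open>v\<close>.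
\<close>

lemma constrained_critical_point_derivatives:
  assumes crit: "constrained_critical_point (potential m) (inertia m) I0 q" and I0: "I0 > 0"
    and dU: "((\<lambda>t. potential m (q + t *\<^sub>R v)) has_real_derivative dU) (at 0)"
    and dI: "((\<lambda>t. inertia m (q + t *\<^sub>R v)) has_real_derivative dI) (at 0)"
  shows "dU + potential m q / (2 * I0) * dI = 0"
proof -
  define J where "J t = inertia m (q + t *\<^sub>R v)" for t
  define \<gamma> where "\<gamma> t = sqrt (I0 / J t) *\<^sub>R (q + t *\<^sub>R v)" for t
  have J0: "J 0 = I0" using crit by (simp add: J_def constrained_critical_point_def)
  have dJ: "(J has_real_derivative dI) (at 0)" using dI by (simp add: J_def[abs_def])
  have "isCont J 0" using dJ by (rule DERIV_isCont)
  then have "(J \<longlongrightarrow> I0) (nhds 0)" by (simp add: J0 isCont_def tendsto_nhds_iff)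
  \<comment> \<open>The scaling factor is meaningful only where \<open>J\<close> is positive, so the
    identities along \<open>\<gamma>\<close> are established near \<open>0\<close> only.\<close>
  then have ev: "\<forall>\<^sub>F t in nhds 0. J t > 0" using I0 by (rule order_tendstoD)
  have sc: "((\<lambda>t. sqrt (I0 / J t)) has_real_derivative - dI / (2 * I0)) (at 0)"
    using I0 by (auto intro!: derivative_eq_intros dJ simp: J0 field_simps)
  have "(\<gamma> has_vector_derivative (1 *\<^sub>R v + (- dI / (2 * I0)) *\<^sub>R q)) (at 0)"
  proof -
    have "((\<lambda>t. q + t *\<^sub>R v) has_vector_derivative v) (at 0)"
      by (auto intro!: derivative_eq_intros)
    from has_vector_derivative_scaleR[OF sc this] show ?thesis
      using I0 by (simp add: \<gamma>_def[abs_def] J0)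
  qed
  moreover have "\<forall>\<^sub>F t in nhds 0. inertia m (\<gamma> t) = I0"
    using ev
  proof eventually_elim
    case (elim t)
    then show ?case using I0 by (simp add: \<gamma>_def inertia_scaleR flip: J_def)
  qed
  moreover have "\<gamma> 0 = q" using I0 by (simp add: \<gamma>_def J0)
  ultimately have z: "((\<lambda>t. potential m (\<gamma> t)) has_real_derivative 0) (at 0)"
    using crit by (auto simp: constrained_critical_point_def)
  \<comment> \<open>Since the potential is homogeneous of degree -1, this product is the potential
    along \<open>\<gamma>\<close> near \<open>0\<close>. The product rule gives its derivative,
    which criticality forces to vanish.\<close>
  have "((\<lambda>t. potential m (q + t *\<^sub>R v) * sqrt (J t / I0)) has_real_derivative
      dU + potential m q / (2 * I0) * dI) (at 0)"
    using I0 by (auto intro!: derivative_eq_intros dU dJ simp: J0 field_simps)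
  moreover have "\<forall>\<^sub>F t in nhds 0. potential m (\<gamma> t) = potential m (q + t *\<^sub>R v) * sqrt (J t / I0)"
    using ev
  proof eventually_elim
    case (elim t)
    then show ?case using I0 by (simp add: \<gamma>_def potential_scaleR real_sqrt_divide)
  qed
  ultimately have "((\<lambda>t. potential m (\<gamma> t)) has_real_derivative
      dU + potential m q / (2 * I0) * dI) (at 0)"
    using DERIV_cong_ev[OF refl _ refl] by fast
  with z show ?thesis using DERIV_unique by blast
qed

text \<open>Only body \<open>i\<close> is moved, in direction \<open>e\<close>. The factor 2 in the
  derivative of the inertia cancels the one in the multiplier, and the positive mass of body
  \<open>i\<close> is divided out. The summand \<open>j = i\<close> vanishes because its position
  difference is 0.\<close>

lemma constrained_critical_point_equations:
  assumes crit: "constrained_critical_point (potential m) (inertia m) I0 q" and I0: "I0 > 0"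
  shows "(\<Sum>j\<in>UNIV.
    m $ j * (1 / dist (q $ i) (q $ j) ^ 3 - potential m q / (I0 * total_mass m)) * ((q $ i - q $ j) \<bullet> e)) = 0"
proof -
  define v :: "real^2^4" where "v = axis i e"
  define lam where "lam = potential m q / (I0 * total_mass m)"
  define f where "f k j =
    m $ k * m $ j * (1 / dist (q $ k) (q $ j) ^ 3 - lam) * ((q $ k - q $ j) \<bullet> (v $ k - v $ j))" for k j
  define g where "g k j =
    m $ k * (m $ j * (1 / dist (q $ k) (q $ j) ^ 3 - lam) * ((q $ k - q $ j) \<bullet> v $ k))" for k j
  have "(\<Sum>(k, j) \<in> {(k, j). k < j}. f k j) = 0"
  proof -
    define c where "c k j = m $ k * m $ j * ((q $ k - q $ j) \<bullet> (v $ k - v $ j))" for k j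
    have fc: "f k j = c k j * (1 / dist (q $ k) (q $ j) ^ 3 - lam)" for k j
      by (simp add: f_def c_def mult_ac)
    have "(\<Sum>(k, j) \<in> {(k, j). k < j}.
          m $ k * m $ j * (- ((q $ k - q $ j) \<bullet> (v $ k - v $ j)) / dist (q $ k) (q $ j) ^ 3))
        + lam * (\<Sum>(k, j) \<in> {(k, j). k < j}. c k j) = 0"
      using constrained_critical_point_derivatives[OF crit I0 potential_line_derivative[of v] inertia_line_derivative[of v]]
      by (simp add: lam_def c_def mult_ac)
    also have "(\<Sum>(k, j) \<in> {(k, j). k < j}.
          m $ k * m $ j * (- ((q $ k - q $ j) \<bullet> (v $ k - v $ j)) / dist (q $ k) (q $ j) ^ 3))
      = (\<Sum>(k, j) \<in> {(k, j). k < j}. - (c k j / dist (q $ k) (q $ j) ^ 3))"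
      by (intro sum.cong) (auto simp: c_def)
    also have "\<dots> + lam * (\<Sum>(k, j) \<in> {(k, j). k < j}. c k j) = - (\<Sum>(k, j) \<in> {(k, j). k < j}. f k j)"
      unfolding sum_distrib_left sum.distrib[symmetric] sum_negf[symmetric]
      by (intro sum.cong refl) (auto simp: fc algebra_simps)
    finally show ?thesis by simp
  qed
  moreover have "f k j = f j k" for k j
  proof -
    have "(q $ k - q $ j) \<bullet> (v $ k - v $ j) = (q $ j - q $ k) \<bullet> (v $ j - v $ k)"
      by (simp add: inner_diff_left inner_diff_right)
    then show ?thesis
      by (simp only: f_def dist_commute[of "q $ k" "q $ j"] mult.commute[of "m $ k" "m $ j"])
  qed
  ultimately have "(\<Sum>k\<in>UNIV. \<Sum>j\<in>UNIV. f k j) = 0"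
    using sum_symmetric_pairs[of f] by (simp add: f_def)
  \<comment> \<open>Here \<open>g k j\<close> is the share due to the motion of body
    \<open>k\<close>. As \<open>v\<close> vanishes off \<open>i\<close>, only row \<open>i\<close>
    of \<open>g\<close> survives, and both halves of the double sum agree after swapping
    indices.\<close>
  moreover have "f k j = g k j + g j k" for k j
  proof -
    have "(q $ k - q $ j) \<bullet> (v $ k - v $ j) = (q $ k - q $ j) \<bullet> v $ k + (q $ j - q $ k) \<bullet> v $ j"
      by (simp add: inner_diff_left inner_diff_right)
    then show ?thesis
      by (simp only: f_def g_def dist_commute[of "q $ j" "q $ k"] distrib_left mult_ac)
  qed
  ultimately have "(\<Sum>k\<in>UNIV. \<Sum>j\<in>UNIV. g k j) + (\<Sum>k\<in>UNIV. \<Sum>j\<in>UNIV. g j k) = 0"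
    by (simp add: sum.distrib)
  moreover have "(\<Sum>k\<in>UNIV. \<Sum>j\<in>UNIV. g j k) = (\<Sum>k\<in>UNIV. \<Sum>j\<in>UNIV. g k j)"
    by (rule sum.swap)
  moreover have "(\<Sum>k\<in>UNIV. \<Sum>j\<in>UNIV. g k j) = (\<Sum>k\<in>UNIV. if k = i then (\<Sum>j\<in>UNIV. g i j) else 0)"
    by (intro sum.cong) (auto simp: g_def v_def axis_def)
  ultimately have "(\<Sum>j\<in>UNIV. g i j) = 0" by simp
  moreover have "(\<Sum>j\<in>UNIV. g i j) =
      m $ i * (\<Sum>j\<in>UNIV. m $ j * (1 / dist (q $ i) (q $ j) ^ 3 - lam) * ((q $ i - q $ j) \<bullet> e))"
    by (simp add: g_def v_def sum_distrib_left)
  ultimately show ?thesis using masses_pos[of i] by (simp add: lam_def)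
qed

end

section \<open>Comparison of opposite sides and the relations of Dziobek\<close>

lemma power2_eq_powr_of_inverse_cube:
  fixes r x :: real
  assumes "r > 0" "1 / r ^ 3 = x"
  shows "r\<^sup>2 = x powr (-2/3)"
proof -
  have "x = r powr (-3)"
    using assms by (simp add: powr_minus_divide)
  then have "x powr (-2/3) = r powr 2"
    by (simp add: powr_powr)
  then show ?thesis using assms by simp
qed

text \<open>Dividing \<open>S\<close> by \<open>l\<close> turns the bound \<open>l\<^sup>2\<close>
  into 1 and makes \<open>r\<^sup>2\<close> a fixed multiple of
  \<open>(1 + u r) powr (-2/3)\<close>. Since \<open>1 / r ^ 3\<close> decreases, the longest side
  \<open>a\<close> has the smallest \<open>u\<close>, as \<open>hyperbola_comparison\<close>
  demands.\<close>

lemma opposite_sides_comparison: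
  fixes a b c d l :: real
  defines "S \<equiv> \<lambda>r. 1 / r ^ 3 - l"
  assumes pos: "a > 0" "b > 0" "c > 0" "d > 0" "l > 0"
    and S_pos: "S a > 0"
    and le: "c \<le> a" "d \<le> a"
    and eq: "S a * S b = S c * S d" and le1: "S c * S d \<le> l\<^sup>2"
  shows "a\<^sup>2 + b\<^sup>2 < c\<^sup>2 + d\<^sup>2 \<or> a = c \<and> b = d \<or> a = d \<and> b = c"
proof -
  define u where "u r = S r / l" for r
  have sq: "r\<^sup>2 = l powr (-2/3) * (1 + u r) powr (-2/3)" if "r > 0" for r
  proof -
    have "1 + u r = 1 / (l * r ^ 3)" using pos that by (simp add: u_def S_def field_simps)
    then have "1 / r ^ 3 = l * (1 + u r)" "1 + u r > 0" using pos that by simp_all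
    then show ?thesis
      using power2_eq_powr_of_inverse_cube[OF that] pos by (simp add: powr_mult)
  qed
  have u_inj: "x = y" if "u x = u y" "x > 0" "y > 0" for x y
  proof (rule power2_eq_imp_eq)
    show "x\<^sup>2 = y\<^sup>2" by (simp only: sq[OF that(2)] sq[OF that(3)] that(1))
  qed (use that in simp_all)
  have "1 / a ^ 3 \<le> 1 / c ^ 3" "1 / a ^ 3 \<le> 1 / d ^ 3"
    using le pos by (auto intro!: divide_left_mono power_mono)
  then have "u a \<le> u c" "u a \<le> u d" using pos by (auto simp: u_def S_def divide_right_mono)
  moreover have "u a > 0" using S_pos pos by (simp add: u_def)
  moreover have "u a * u b = u c * u d" "u c * u d \<le> 1"
    using eq le1 pos by (simp_all add: u_def power2_eq_square)
  ultimately consider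
      "(1 + u a) powr (-2/3) + (1 + u b) powr (-2/3) < (1 + u c) powr (-2/3) + (1 + u d) powr (-2/3)"
    | "u a = u c" "u b = u d" | "u a = u d" "u b = u c"
    using hyperbola_comparison by blast
  then show ?thesis
  proof cases
    case 1
    then have "l powr (-2/3) * ((1 + u a) powr (-2/3) + (1 + u b) powr (-2/3))
        < l powr (-2/3) * ((1 + u c) powr (-2/3) + (1 + u d) powr (-2/3))"
      using pos by (intro mult_strict_left_mono) auto
    then show ?thesis
      by (simp only: sq[OF pos(1)] sq[OF pos(2)] sq[OF pos(3)] sq[OF pos(4)] distrib_left simp_thms)
  qed (use u_inj pos in auto)
qed

text \<open>Each of \<open>e1\<close> to \<open>e4\<close> is the equation of one body tested with
  the normal of its own diagonal; \<open>d13\<close> and \<open>d24\<close> are those of bodies 1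
  and 2 tested with the normal of the other diagonal. Multiplying suitable pairs gives the product
  relations, and the positive coefficients transport the signs.\<close>

lemma dziobek_relations:
  fixes m\<^sub>1 m\<^sub>2 m\<^sub>3 m\<^sub>4 b c :: real
  assumes pos: "m\<^sub>1 > 0" "m\<^sub>2 > 0" "m\<^sub>3 > 0" "m\<^sub>4 > 0" "b > 0" "c > 0"
    and e1: "m\<^sub>2 * S\<^sub>1\<^sub>2 = c * m\<^sub>4 * S\<^sub>1\<^sub>4"
    and e3: "m\<^sub>2 * S\<^sub>2\<^sub>3 = c * m\<^sub>4 * S\<^sub>3\<^sub>4"
    and e2: "m\<^sub>1 * S\<^sub>1\<^sub>2 = b * m\<^sub>3 * S\<^sub>2\<^sub>3"
    and e4: "m\<^sub>1 * S\<^sub>1\<^sub>4 = b * m\<^sub>3 * S\<^sub>3\<^sub>4"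
    and d13: "m\<^sub>2 * S\<^sub>1\<^sub>2 + m\<^sub>4 * S\<^sub>1\<^sub>4 = - (1 + b) * m\<^sub>3 * S\<^sub>1\<^sub>3"
    and d24: "m\<^sub>1 * S\<^sub>1\<^sub>2 + m\<^sub>3 * S\<^sub>2\<^sub>3 = - (1 + c) * m\<^sub>4 * S\<^sub>2\<^sub>4"
  shows "S\<^sub>1\<^sub>2 * S\<^sub>3\<^sub>4 = S\<^sub>1\<^sub>4 * S\<^sub>2\<^sub>3" and "S\<^sub>1\<^sub>4 * S\<^sub>2\<^sub>3 = S\<^sub>1\<^sub>3 * S\<^sub>2\<^sub>4"
    and "sgn S\<^sub>1\<^sub>4 = sgn S\<^sub>1\<^sub>2" and "sgn S\<^sub>2\<^sub>3 = sgn S\<^sub>1\<^sub>2" and "sgn S\<^sub>3\<^sub>4 = sgn S\<^sub>1\<^sub>2"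
    and "sgn S\<^sub>1\<^sub>3 = - sgn S\<^sub>1\<^sub>2" and "sgn S\<^sub>2\<^sub>4 = - sgn S\<^sub>1\<^sub>2"
proof -
  have "(m\<^sub>2 * S\<^sub>1\<^sub>2) * (c * m\<^sub>4 * S\<^sub>3\<^sub>4) = (c * m\<^sub>4 * S\<^sub>1\<^sub>4) * (m\<^sub>2 * S\<^sub>2\<^sub>3)"
    by (simp only: e1 e3)
  then show "S\<^sub>1\<^sub>2 * S\<^sub>3\<^sub>4 = S\<^sub>1\<^sub>4 * S\<^sub>2\<^sub>3" using pos by simp
  have d13': "(1 + c) * (m\<^sub>4 * S\<^sub>1\<^sub>4) = - ((1 + b) * (m\<^sub>3 * S\<^sub>1\<^sub>3))"
    using d13 e1 by (simp add: algebra_simps)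
  have d24': "(1 + b) * (m\<^sub>3 * S\<^sub>2\<^sub>3) = - ((1 + c) * (m\<^sub>4 * S\<^sub>2\<^sub>4))"
    using d24 e2 by (simp add: algebra_simps)
  have "((1 + c) * (m\<^sub>4 * S\<^sub>1\<^sub>4)) * ((1 + b) * (m\<^sub>3 * S\<^sub>2\<^sub>3)) =
      ((1 + b) * (m\<^sub>3 * S\<^sub>1\<^sub>3)) * ((1 + c) * (m\<^sub>4 * S\<^sub>2\<^sub>4))"
    by (simp only: d13' d24' minus_mult_minus)
  then show "S\<^sub>1\<^sub>4 * S\<^sub>2\<^sub>3 = S\<^sub>1\<^sub>3 * S\<^sub>2\<^sub>4" using pos by simp
  have s: "sgn b = 1" "sgn c = 1" "sgn (1 + b) = 1" "sgn (1 + c) = 1"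
      "sgn m\<^sub>1 = 1" "sgn m\<^sub>2 = 1" "sgn m\<^sub>3 = 1" "sgn m\<^sub>4 = 1"
    using pos by simp_all
  show s14: "sgn S\<^sub>1\<^sub>4 = sgn S\<^sub>1\<^sub>2" using arg_cong[OF e1, of sgn] s by (simp add: sgn_mult)
  show s23: "sgn S\<^sub>2\<^sub>3 = sgn S\<^sub>1\<^sub>2" using arg_cong[OF e2, of sgn] s by (simp add: sgn_mult)
  show "sgn S\<^sub>3\<^sub>4 = sgn S\<^sub>1\<^sub>2" using arg_cong[OF e4, of sgn] s s14 by (simp add: sgn_mult)
  show "sgn S\<^sub>1\<^sub>3 = - sgn S\<^sub>1\<^sub>2" using arg_cong[OF d13', of sgn] s s14 by (simp add: sgn_mult sgn_minus)
  show "sgn S\<^sub>2\<^sub>4 = - sgn S\<^sub>1\<^sub>2" using arg_cong[OF d24', of sgn] s s23 by (simp add: sgn_mult sgn_minus)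
qed

section \<open>Geometry of the convex quadrilateral\<close>

lemma closed_segment_interior_point:
  fixes x y p :: "'a::real_vector"
  assumes "p \<in> closed_segment x y" "p \<noteq> x" "p \<noteq> y"
  shows "\<exists>t>0. y = p - t *\<^sub>R (x - p)"
proof -
  obtain s where s: "p = (1 - s) *\<^sub>R x + s *\<^sub>R y" "0 \<le> s" "s \<le> 1"
    using assms(1) by (auto simp: in_segment)
  have "s \<noteq> 0" "s \<noteq> 1" using s assms by auto
  then have "0 < (1 - s) / s" using s by simp
  moreover have "s *\<^sub>R (x - y) = x - p" "(1 - s) *\<^sub>R (x - y) = p - y"
    by (simp_all add: s algebra_simps)
  then have "p - y = ((1 - s) / s) *\<^sub>R (x - p)"
    using \<open>s \<noteq> 0\<close>
    by (metis divide_self_if mult.commute scaleR_scaleR times_divide_eq_left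
        nonzero_mult_div_cancel_left)
  then have "y = p - ((1 - s) / s) *\<^sub>R (x - p)" by (simp add: algebra_simps)
  ultimately show ?thesis by blast
qed

lemma convex_configuration_not_in_segment:
  assumes "convex_configuration q" "j \<noteq> i" "k \<noteq> i"
  shows "q $ i \<notin> closed_segment (q $ j) (q $ k)"
proof -
  have "closed_segment (q $ j) (q $ k) \<subseteq> convex hull ((\<lambda>j. q $ j) ` (- {i}))"
    unfolding segment_convex_hull using assms by (intro hull_mono) auto
  then show ?thesis using assms by (auto simp: convex_configuration_def)
qed

text \<open>The counterclockwise rotation by a right angle. Thus \<open>x \<bullet> perp y\<close>
  is the determinant with rows \<open>y\<close> and \<open>x\<close>, and testing with
  \<open>perp y\<close> removes multiples of \<open>y\<close>.\<close>

definition perp :: "real^2 \<Rightarrow> real^2" where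
  "perp x = vector [- x $ 2, x $ 1]"

lemma inner_perp: "x \<bullet> perp y = x $ 2 * y $ 1 - x $ 1 * y $ 2"
  by (simp add: perp_def inner_vec_def sum_2)

lemma inner_perp_self [simp]: "x \<bullet> perp x = 0"
  by (simp add: inner_perp)

text \<open>Measured from \<open>P\<close>, opposite bodies are negative multiples of each other.
  The turn at \<open>q $ 2\<close> then equals \<open>(1 + b) * (B \<bullet> perp A)\<close>, so the
  orientation gives the last sign.\<close>

lemma convex_quadrilateral_diagonals:
  assumes convex: "convex_configuration q" and ccw: "labeled_counterclockwise q"
    and P13: "P \<in> closed_segment (q $ 1) (q $ 3)" and P24: "P \<in> closed_segment (q $ 2) (q $ 4)"
  obtains A B b c where "q $ 1 = P + A" "q $ 2 = P + B" "q $ 3 = P - b *\<^sub>R A" "q $ 4 = P - c *\<^sub>R B"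
    "b > 0" "c > 0" "B \<bullet> perp A > 0"
proof -
  \<comment> \<open>A vertex equal to \<open>P\<close> would lie on the other diagonal, contrary to
    convexity.\<close>
  have "P \<noteq> q $ 1" "P \<noteq> q $ 2" "P \<noteq> q $ 3" "P \<noteq> q $ 4"
    using P13 P24 convex_configuration_not_in_segment[OF convex, of 2 1 4]
      convex_configuration_not_in_segment[OF convex, of 1 2 3]
      convex_configuration_not_in_segment[OF convex, of 2 3 4]
      convex_configuration_not_in_segment[OF convex, of 1 4 3] by auto
  then obtain b c where bc: "b > 0" "q $ 3 = P - b *\<^sub>R (q $ 1 - P)" "c > 0" "q $ 4 = P - c *\<^sub>R (q $ 2 - P)"
    using closed_segment_interior_point[OF P13] closed_segment_interior_point[OF P24] by metis
  define A B where "A = q $ 1 - P" and "B = q $ 2 - P"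
  have "0 < det (vector [q $ (1 + 1) - q $ 1, q $ (1 + 2) - q $ (1 + 1)] :: real^2^2)"
    using ccw unfolding labeled_counterclockwise_def by blast
  also have "\<dots> = det (vector [B - A, - b *\<^sub>R A - B] :: real^2^2)"
    by (simp add: A_def B_def bc(2) algebra_simps)
  also have "\<dots> = (1 + b) * (B \<bullet> perp A)"
    by (simp add: det_2 inner_perp algebra_simps)
  finally have "B \<bullet> perp A > 0" using bc(1) by (simp add: zero_less_mult_iff)
  then show thesis using that[of A B b c] bc by (simp add: A_def B_def)
qed

lemma dist_cross_square:
  fixes A B P :: "'a::real_inner"
  shows "(dist (P + s *\<^sub>R A) (P + t *\<^sub>R B))\<^sup>2 =
    s\<^sup>2 * (norm A)\<^sup>2 + t\<^sup>2 * (norm B)\<^sup>2 - 2 * s * t * (A \<bullet> B)"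
proof -
  have "(dist (P + s *\<^sub>R A) (P + t *\<^sub>R B))\<^sup>2 = (s *\<^sub>R A - t *\<^sub>R B) \<bullet> (s *\<^sub>R A - t *\<^sub>R B)"
    by (simp add: dist_norm power2_norm_eq_inner)
  also have "\<dots> = s * s * (A \<bullet> A) + t * t * (B \<bullet> B) - 2 * s * t * (A \<bullet> B)"
    by (simp add: inner_diff_left inner_diff_right inner_commute)
  finally show ?thesis by (simp add: power2_eq_square dot_square_norm)
qed

lemma inverse_cube_le_iff:
  fixes r s :: real
  assumes "r > 0" "s > 0"
  shows "1 / r ^ 3 \<le> 1 / s ^ 3 \<longleftrightarrow> s \<le> r"
  using assms by (simp add: divide_le_eq_1 field_simps power_mono_iff)

section \<open>The bounds on the angle and the kite\<close>

theorem theorem3p8: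
  fixes m :: "real^4" and q :: "real^2^4" and P :: "real^2" and \<theta> :: real
  assumes masses_pos: "\<And>i. m $ i > 0"
    and central: "central_configuration m q"
    and convex_config: "convex_configuration q"
    and ccw: "labeled_counterclockwise q"
    and r12_ge_r23: "dist (q $ 2) (q $ 3) \<le> dist (q $ 1) (q $ 2)"
    and r12_ge_r34: "dist (q $ 3) (q $ 4) \<le> dist (q $ 1) (q $ 2)"
    and r12_ge_r14: "dist (q $ 1) (q $ 4) \<le> dist (q $ 1) (q $ 2)"
    and P_diag13: "P \<in> closed_segment (q $ 1) (q $ 3)"
    and P_diag24: "P \<in> closed_segment (q $ 2) (q $ 4)"
    and theta: "\<theta> = angle_at (q $ 1) P (q $ 2)"
  shows "pi / 3 < \<theta> \<and> \<theta> \<le> pi / 2 \<and> (\<theta> = pi / 2 \<longrightarrow> is_kite q)"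
proof -
  obtain I0 where I0: "I0 > 0" and crit: "constrained_critical_point (potential m) (inertia m) I0 q"
    and inj: "inj (\<lambda>i. q $ i)"
    using central by (auto simp: central_configuration_def)
  obtain A B b c where q: "q $ 1 = P + A" "q $ 2 = P + B" "q $ 3 = P - b *\<^sub>R A" "q $ 4 = P - c *\<^sub>R B"
    and bc: "b > 0" "c > 0" and D: "B \<bullet> perp A > 0"
    using convex_quadrilateral_diagonals[OF convex_config ccw P_diag13 P_diag24] .
  have D': "A \<bullet> perp B < 0" using D by (simp add: inner_perp algebra_simps)
  have nz: "A \<noteq> 0" "B \<noteq> 0" using D D' by auto
  define l where "l = potential m q / (I0 * total_mass m)"
  have l: "l > 0"
    using I0 potential_pos[OF masses_pos inj] total_mass_pos[OF masses_pos] by (simp add: l_def)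
  define r where "r i j = dist (q $ i) (q $ j)" for i j
  define S where "S i j = 1 / r i j ^ 3 - l" for i j
  have r_pos: "r i j > 0" if "i \<noteq> j" for i j
    using that inj by (auto simp: r_def inj_eq)
  have r_le: "r k n \<le> r i j" if "S i j \<le> S k n" "i \<noteq> j" "k \<noteq> n" for i j k n
    using inverse_cube_le_iff[OF r_pos[OF that(2)] r_pos[OF that(3)]] that(1) by (simp add: S_def)
  have S_comm: "S j i = S i j" for i j by (simp add: S_def r_def dist_commute)
  \<comment> \<open>The term of body \<open>i\<close> itself has \<open>S i i = - l\<close>, as
    division by zero yields 0, but its position difference is 0.\<close>
  have newton: "m $ 1 * S i 1 * ((q $ i - q $ 1) \<bullet> e) + m $ 2 * S i 2 * ((q $ i - q $ 2) \<bullet> e)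
      + m $ 3 * S i 3 * ((q $ i - q $ 3) \<bullet> e) + m $ 4 * S i 4 * ((q $ i - q $ 4) \<bullet> e) = 0" for i e
    using constrained_critical_point_equations[OF masses_pos inj crit I0, of i e]
    by (simp add: sum_4 S_def r_def l_def)
  \<comment> \<open>The normal of the diagonal through a body removes the opposite body, which
    leaves a relation between two adjacent sides.\<close>
  have "(m $ 2 * S 1 2 - c * m $ 4 * S 1 4) * (B \<bullet> perp A) = 0"
    using newton[of 1 "perp A"] by (auto simp: q inner_simps algebra_simps)
  then have e1: "m $ 2 * S 1 2 = c * m $ 4 * S 1 4" using D by simp
  have "(m $ 2 * S 2 3 - c * m $ 4 * S 3 4) * (B \<bullet> perp A) = 0"
    using newton[of 3 "perp A"] by (auto simp: q S_comm[of 3 2] inner_simps algebra_simps)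
  then have e3: "m $ 2 * S 2 3 = c * m $ 4 * S 3 4" using D by simp
  have "(m $ 1 * S 1 2 - b * m $ 3 * S 2 3) * (A \<bullet> perp B) = 0"
    using newton[of 2 "perp B"] by (auto simp: q S_comm[of 2 1] inner_simps algebra_simps)
  then have e2: "m $ 1 * S 1 2 = b * m $ 3 * S 2 3" using D' by simp
  have "(m $ 1 * S 1 4 - b * m $ 3 * S 3 4) * (A \<bullet> perp B) = 0"
    using newton[of 4 "perp B"] by (auto simp: q S_comm[of 4 1] S_comm[of 4 3] inner_simps algebra_simps)
  then have e4: "m $ 1 * S 1 4 = b * m $ 3 * S 3 4" using D' by simp
  \<comment> \<open>The normal of the other diagonal keeps the opposite body and so brings in the
    diagonal term.\<close>
  have "(m $ 2 * S 1 2 + m $ 4 * S 1 4 + (1 + b) * m $ 3 * S 1 3) * (A \<bullet> perp B) = 0"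
    using newton[of 1 "perp B"] by (auto simp: q inner_simps algebra_simps)
  then have "m $ 2 * S 1 2 + m $ 4 * S 1 4 + (1 + b) * m $ 3 * S 1 3 = 0" using D' by auto
  then have d13: "m $ 2 * S 1 2 + m $ 4 * S 1 4 = - (1 + b) * m $ 3 * S 1 3"
    by (simp add: algebra_simps)
  have "(m $ 1 * S 1 2 + m $ 3 * S 2 3 + (1 + c) * m $ 4 * S 2 4) * (B \<bullet> perp A) = 0"
    using newton[of 2 "perp A"] by (auto simp: q S_comm[of 2 1] inner_simps algebra_simps)
  then have "m $ 1 * S 1 2 + m $ 3 * S 2 3 + (1 + c) * m $ 4 * S 2 4 = 0" using D by auto
  then have d24: "m $ 1 * S 1 2 + m $ 3 * S 2 3 = - (1 + c) * m $ 4 * S 2 4"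
    by (simp add: algebra_simps)
  note dz = dziobek_relations[OF masses_pos[of 1] masses_pos[of 2] masses_pos[of 3] masses_pos[of 4]
      bc e1 e3 e2 e4 d13 d24]

  define a where "a = norm A"
  define a' where "a' = norm B"
  define x where "x = A \<bullet> B"
  have a: "a > 0" "a' > 0" using nz by (auto simp: a_def a'_def)
  have r12: "(r 1 2)\<^sup>2 = a\<^sup>2 + a'\<^sup>2 - 2 * x"
    and r23: "(r 2 3)\<^sup>2 = b\<^sup>2 * a\<^sup>2 + a'\<^sup>2 + 2 * b * x"
    and r34: "(r 3 4)\<^sup>2 = b\<^sup>2 * a\<^sup>2 + c\<^sup>2 * a'\<^sup>2 - 2 * b * c * x"
    and r14: "(r 1 4)\<^sup>2 = a\<^sup>2 + c\<^sup>2 * a'\<^sup>2 + 2 * c * x"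
    using dist_cross_square[of P 1 A 1 B] dist_cross_square[of P "- b" A 1 B]
      dist_cross_square[of P "- b" A "- c" B] dist_cross_square[of P 1 A "- c" B]
    by (simp_all add: r_def q a_def a'_def x_def dist_commute)
  have r13: "r 1 3 = (1 + b) * a"
  proof -
    have "q $ 1 - q $ 3 = (1 + b) *\<^sub>R A" by (simp add: q algebra_simps)
    then show ?thesis using bc by (simp add: r_def a_def dist_norm)
  qed
  have r24: "r 2 4 = (1 + c) * a'"
  proof -
    have "q $ 2 - q $ 4 = (1 + c) *\<^sub>R B" by (simp add: q algebra_simps)
    then show ?thesis using bc by (simp add: r_def a'_def dist_norm)
  qed

  \<comment> \<open>Otherwise the signs of all \<open>S\<close> are reversed and no side is shorter
    than a diagonal. But the diagonals together are longer than a pair of opposite sides: the pair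
    facing the angle at \<open>P\<close> that is not obtuse, chosen by the sign of
    \<open>x\<close>.\<close>
  have S12: "S 1 2 > 0"
  proof (rule ccontr)
    assume "\<not> S 1 2 > 0"
    then have "S 1 2 \<le> 0" "S 1 4 \<le> 0" "S 2 3 \<le> 0" "S 3 4 \<le> 0" "S 1 3 \<ge> 0" "S 2 4 \<ge> 0"
      using dz(3-7) by (auto simp: sgn_if split: if_splits)
    then have "r 1 3 \<le> r 1 2" "r 2 4 \<le> r 3 4" "r 1 3 \<le> r 1 4" "r 2 4 \<le> r 2 3"
      by (simp_all add: r_le)
    then have le: "r 1 3 + r 2 4 \<le> r 1 2 + r 3 4" "r 1 3 + r 2 4 \<le> r 1 4 + r 2 3" by simp_all
    show False
    proof (cases "x \<ge> 0")
      case True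
      have "0 \<le> b * c * x" "0 < a * a'" "0 < b * a * (c * a')" using True a bc by simp_all
      then have "(r 1 2)\<^sup>2 < (a + a')\<^sup>2" "(r 3 4)\<^sup>2 < (b * a + c * a')\<^sup>2"
        unfolding r12 r34 power2_sum power_mult_distrib using True by linarith+
      then have "r 1 2 < a + a'" "r 3 4 < b * a + c * a'"
        using a bc by (auto intro: power2_less_imp_less)
      then show False using le by (simp add: r13 r24 algebra_simps)
    next
      case False
      then have "c * x < 0" "b * x < 0" using bc by (simp_all add: mult_pos_neg)
      moreover have "0 < a * (c * a')" "0 < b * a * a'" using a bc by simp_all
      ultimately have "(r 1 4)\<^sup>2 < (a + c * a')\<^sup>2" "(r 2 3)\<^sup>2 < (b * a + a')\<^sup>2"
        unfolding r14 r23 power2_sum power_mult_distrib by linarith+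
      then have "r 1 4 < a + c * a'" "r 2 3 < b * a + a'"
        using a bc by (auto intro: power2_less_imp_less)
      then show False using le by (simp add: r13 r24 algebra_simps)
    qed
  qed
  then have "S 1 3 < 0" "S 2 4 < 0" using dz(6,7) by (auto simp: sgn_if split: if_splits)
  moreover have "S 1 3 \<ge> - l" "S 2 4 \<ge> - l" using r_pos[of 1 3] r_pos[of 2 4] by (simp_all add: S_def)
  ultimately have "(- S 1 3) * (- S 2 4) \<le> l * l" using l by (intro mult_mono) auto
  then have "S 1 4 * S 2 3 \<le> l\<^sup>2" using dz(2) by (simp add: power2_eq_square)
  then have cmp: "(r 1 2)\<^sup>2 + (r 3 4)\<^sup>2 < (r 1 4)\<^sup>2 + (r 2 3)\<^sup>2 \<or>
      r 1 2 = r 1 4 \<and> r 3 4 = r 2 3 \<or> r 1 2 = r 2 3 \<and> r 3 4 = r 1 4"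
    using opposite_sides_comparison[of "r 1 2" "r 3 4" "r 1 4" "r 2 3" l] r_pos S12 l dz(1)
      r12_ge_r14 r12_ge_r23 by (simp add: S_def r_def)
  have diff: "(r 1 2)\<^sup>2 + (r 3 4)\<^sup>2 - ((r 1 4)\<^sup>2 + (r 2 3)\<^sup>2) = - (2 * (1 + b) * (1 + c) * x)"
    by (simp add: r12 r34 r14 r23 algebra_simps)
  \<comment> \<open>A negative \<open>x\<close> would make the difference in \<open>diff\<close>
    positive, whereas it is negative or zero in every case of \<open>cmp\<close>.\<close>
  have x_nonneg: "x \<ge> 0"
  proof (rule ccontr)
    assume "\<not> x \<ge> 0"
    then have "2 * (1 + b) * (1 + c) * x < 0" using bc by (simp add: mult_pos_neg)
    then show False using cmp diff by auto
  qed
  have x_less: "2 * x < a * a'"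
  proof (rule ccontr)
    assume "\<not> 2 * x < a * a'"
    then have x: "a * a' \<le> 2 * x" by simp
    have "(r 1 4)\<^sup>2 \<le> (r 1 2)\<^sup>2" "(r 2 3)\<^sup>2 \<le> (r 1 2)\<^sup>2"
      using r12_ge_r14 r12_ge_r23 by (auto simp: r_def intro!: power_mono)
    \<comment> \<open>These are the differences of squared sides in factored form. With
      \<open>a * a' \<le> 2 * x\<close> they would give both \<open>a < a'\<close> and
      \<open>a' < a\<close>.\<close>
    then have "0 \<le> (1 + c) * ((1 - c) * a'\<^sup>2 - 2 * x)" "0 \<le> (1 + b) * ((1 - b) * a\<^sup>2 - 2 * x)"
      unfolding r12 r14 r23 by (simp_all add: power2_eq_square algebra_simps)
    then have "2 * x \<le> (1 - c) * a'\<^sup>2" "2 * x \<le> (1 - b) * a\<^sup>2"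
      using bc by (simp_all add: zero_le_mult_iff)
    moreover have "(1 - c) * a'\<^sup>2 < a'\<^sup>2" "(1 - b) * a\<^sup>2 < a\<^sup>2" using a bc by (simp_all add: algebra_simps)
    ultimately have "a * a' < a' * a'" "a * a' < a * a" using x by (simp_all add: power2_eq_square)
    then show False using a by simp
  qed
  define y where "y = x / (a * a')"
  have th: "\<theta> = arccos y"
    by (simp add: theta angle_at_def q y_def x_def a_def a'_def)
  have y: "0 \<le> y" "y < 1 / 2"
    using x_nonneg x_less a by (simp_all add: y_def field_simps)
  have "arccos (1 / 2) < \<theta>" unfolding th using y by (intro arccos_less_arccos) auto
  moreover have "\<theta> \<le> arccos 0" unfolding th using y by (intro arccos_le_arccos) auto
  moreover have "is_kite q" if "\<theta> = pi / 2"
  proof -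
    have "cos \<theta> = y" unfolding th using y by (intro cos_arccos) auto
    then have x0: "x = 0" using that a by (simp add: y_def)
    \<comment> \<open>For \<open>x = 0\<close> the two sums of squares agree, so only the equality
      cases of \<open>cmp\<close> remain. Either one makes \<open>P\<close> the midpoint of a
      diagonal, and the other diagonal, being perpendicular to it, is the axis of symmetry.\<close>
    then have "r 1 2 = r 1 4 \<or> r 1 2 = r 2 3" using cmp diff by auto
    then show ?thesis
    proof
      assume "r 1 2 = r 1 4"
      then have "a'\<^sup>2 = c\<^sup>2 * a'\<^sup>2" using r12 r14 x0 by simp
      then have "c = 1" using a bc by (simp add: power2_eq_1_iff)
      have "q $ 4 = line_reflection P A (q $ 2)"
        using x0 by (simp add: line_reflection_def q \<open>c = 1\<close> x_def inner_commute)
      moreover have "q $ 1 \<in> line_through P A" "q $ 3 \<in> line_through P A"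
        by (auto simp: line_through_def q intro: exI[of _ 1] exI[of _ "- b"])
      moreover have "{1, 3, 2, 4} = (UNIV :: 4 set)" by (auto simp: UNIV_4)
      ultimately show ?thesis unfolding is_kite_def using nz by blast
    next
      assume "r 1 2 = r 2 3"
      then have "a\<^sup>2 = b\<^sup>2 * a\<^sup>2" using r12 r23 x0 by simp
      then have "b = 1" using a bc by (simp add: power2_eq_1_iff)
      have "q $ 3 = line_reflection P B (q $ 1)"
        using x0 by (simp add: line_reflection_def q \<open>b = 1\<close> x_def)
      moreover have "q $ 2 \<in> line_through P B" "q $ 4 \<in> line_through P B"
        by (auto simp: line_through_def q intro: exI[of _ 1] exI[of _ "- c"])
      moreover have "{2, 4, 1, 3} = (UNIV :: 4 set)" by (auto simp: UNIV_4)
      ultimately show ?thesis unfolding is_kite_def using nz by blast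
    qed
  qed
  ultimately show ?thesis by simp
qed

end
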